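(* Let $L\in\mathbb{R}^{n\times n}$ be symmetric positive definite and $\mathcal{Y}=\{1,\dots,n\}$. The set function $f(Y):=\log\det(L_Y)$ is submodular on $\mathcal{Y}$, with $f(\emptyset)=0$; that is, for any $A\subseteq B\subseteq\mathcal{Y}$ and $j\in\mathcal{Y}\setminus B$, $$f(A\cup\{j\})-f(A)\ \ge\ f(B\cup\{j\})-f(B).$$ Moreover, if $L\succeq I$, then $f$ is monotone nondecreasing, that is, $f(A)\le f(A\cup\{j\})$ for all $A\subseteq\mathcal{Y}$ and $j\in\mathcal{Y}\setminus A$.
   Context: For a matrix $L$ and an index set $Y$, $L_Y=[L_{ij}]_{i,j\in Y}$ is the principal submatrix, with $\det(L_\emptyset)=1$. *)

theory Defs
  imports
    Complex_Main
    "Jordan_Normal_Form.Determinant"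
    "Jordan_Normal_Form.DL_Submatrix"
begin

definition symmetric_mat :: "'a mat \<Rightarrow> bool" where
  "symmetric_mat A \<longleftrightarrow> transpose_mat A = A"

(* Symmetry forces A to be square. *)
definition pos_definite :: "real mat \<Rightarrow> bool" where
  "pos_definite A \<longleftrightarrow> symmetric_mat A \<and>
     (\<forall>x \<in> carrier_vec (dim_row A). x \<noteq> 0\<^sub>v (dim_row A) \<longrightarrow> 0 < x \<bullet> (A *\<^sub>v x))"

definition pos_semidefinite :: "real mat \<Rightarrow> bool" where
  "pos_semidefinite A \<longleftrightarrow> symmetric_mat A \<and>
     (\<forall>x \<in> carrier_vec (dim_row A). 0 \<le> x \<bullet> (A *\<^sub>v x))"

(* The Loewner order; only meaningful for matrices of equal dimensions. *)
definition loewner_le :: "real mat \<Rightarrow> real mat \<Rightarrow> bool" where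
  "loewner_le A B \<longleftrightarrow> pos_semidefinite (B - A)"

(* Matrix indices start at 0, so the index set of an n x n matrix is {0..<n};
   submatrix lists the rows and columns in Y in increasing order. *)
definition principal_submatrix :: "'a mat \<Rightarrow> nat set \<Rightarrow> 'a mat" where
  "principal_submatrix A Y = submatrix A Y Y"

lemma det_principal_submatrix_empty: "det (principal_submatrix A {}) = 1"
  by (rule det_dim_zero) (auto simp: principal_submatrix_def submatrix_def)

(* ln is a total function with ln 0 = 0; for positive definite A and Y within the index set
   the determinant is positive. *)
definition log_det :: "real mat \<Rightarrow> nat set \<Rightarrow> real" where
  "log_det A Y = ln (det (principal_submatrix A Y))"

definition submodular_on :: "'a set \<Rightarrow> ('a set \<Rightarrow> real) \<Rightarrow> bool" where
  "submodular_on V f \<longleftrightarrow>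
     (\<forall>A B j. A \<subseteq> B \<and> B \<subseteq> V \<and> j \<in> V - B \<longrightarrow> f (A \<union> {j}) - f A \<ge> f (B \<union> {j}) - f B)"

definition monotone_set_function_on :: "'a set \<Rightarrow> ('a set \<Rightarrow> real) \<Rightarrow> bool" where
  "monotone_set_function_on V f \<longleftrightarrow>
     (\<forall>A j. A \<subseteq> V \<and> j \<in> V - A \<longrightarrow> f A \<le> f (A \<union> {j}))"

end

theory Submission
  imports Defs
begin

text \<open>
  For \<open>j \<notin> Y\<close> let \<open>w\<close> be the vector supported on \<open>Y \<union> {j}\<close> whose image under \<open>L\<close> agrees with
  the \<open>j\<close>-th unit vector on \<open>Y \<union> {j}\<close>. By Cramer's rule
  \<open>det L\<^sub>Y = w\<^sub>j * det L\<^bsub>Y \<union> {j}\<^esub>\<close>, so the marginal gain of \<open>j\<close> is \<open>- ln w\<^sub>j\<close>.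
  If \<open>a\<close> and \<open>b\<close> are the vectors of \<open>A \<subseteq> B\<close>, then
  \<open>0 \<le> (b - a)\<^sup>T L (b - a) = b\<^sub>j - 2 a\<^sub>j + a\<^sub>j = b\<^sub>j - a\<^sub>j\<close>, which is submodularity. If \<open>I \<le> L\<close>, then
  \<open>w\<^sub>j\<^sup>2 \<le> w\<^sup>T w \<le> w\<^sup>T L w = w\<^sub>j\<close>, hence \<open>w\<^sub>j \<le> 1\<close>, which is monotonicity.
\<close>

section \<open>Leibniz expansion of principal minors over permutations of the index set\<close>

lemma bij_betw_pick:
  assumes "finite Y"
  shows "bij_betw (pick Y) {0..<card Y} Y"
proof -
  have "Y \<subseteq> pick Y ` {0..<card Y}"
  proof
    fix y assume y: "y \<in> Y"
    then have "{a \<in> Y. a < y} \<subset> Y" by blast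
    then have "card {a \<in> Y. a < y} < card Y"
      by (rule psubset_card_mono[OF assms])
    then show "y \<in> pick Y ` {0..<card Y}"
      using pick_card_in_set[OF y] by (intro image_eqI[where x = "card {a \<in> Y. a < y}"]) auto
  qed
  moreover have "pick Y ` {0..<card Y} \<subseteq> Y"
    using pick_in_set_le by (simp add: image_subset_iff del: pick.simps)
  ultimately have "pick Y ` {0..<card Y} = Y" by (rule equalityI[rotated])
  then show ?thesis
    by (simp add: bij_betw_def eq_card_imp_inj_on)
qed

text \<open>Transporting permutations along the increasing enumeration \<open>pick Y\<close>
  preserves signs, so the Leibniz formula of the submatrix can be written with the original
  indices.\<close>

lemma det_principal_submatrix:
  fixes A :: "'a :: comm_ring_1 mat"
  assumes A: "A \<in> carrier_mat n n" and Y: "Y \<subseteq> {0..<n}"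
  shows "det (principal_submatrix A Y) =
    (\<Sum>p | p permutes Y. signof p * (\<Prod>i\<in>Y. A $$ (i, p i)))"
proof -
  have finY: "finite Y" using Y finite_subset by blast
  define k where "k = card Y"
  let ?K = "{0..<k}"
  let ?f = "pick Y"
  have k: "card {i. i < n \<and> i \<in> Y} = k"
    using Y unfolding k_def by (intro arg_cong[of _ _ card]) auto
  have bij: "bij_betw ?f ?K Y" using bij_betw_pick[OF finY] by (simp add: k_def)
  then have inj: "inj_on ?f ?K" by (simp add: bij_betw_def)
  have bij': "bij_betw (map_permutation ?K ?f) {p. p permutes ?K} {p. p permutes Y}"
  proof (rule bij_betw_byWitness[where f' = "map_permutation Y (inv_into ?K ?f)"])
    show "\<forall>p\<in>{p. p permutes ?K}.
        map_permutation Y (inv_into ?K ?f) (map_permutation ?K ?f p) = p"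
      using bij inj by (auto intro!: map_permutation_compose_inv)
    show "\<forall>p\<in>{p. p permutes Y}.
        map_permutation ?K ?f (map_permutation Y (inv_into ?K ?f) p) = p"
      using bij bij_betw_inv_into[OF bij]
      by (auto intro!: map_permutation_compose_inv simp: bij_betw_inv_into_right)
    show "map_permutation ?K ?f ` {p. p permutes ?K} \<subseteq> {p. p permutes Y}"
      using map_permutation_permutes[OF bij] by auto
    show "map_permutation Y (inv_into ?K ?f) ` {p. p permutes Y} \<subseteq> {p. p permutes ?K}"
      using map_permutation_permutes[OF bij_betw_inv_into[OF bij]] by auto
  qed
  have dim: "principal_submatrix A Y \<in> carrier_mat k k"
    using A k unfolding principal_submatrix_def by (auto simp: dim_submatrix)
  have "(\<Sum>p | p permutes Y. signof p * (\<Prod>i\<in>Y. A $$ (i, p i))) =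
    (\<Sum>p | p permutes ?K. signof (map_permutation ?K ?f p) *
      (\<Prod>i\<in>Y. A $$ (i, map_permutation ?K ?f p i)))"
    by (rule sum.reindex_bij_betw[OF bij', symmetric])
  also have "\<dots> = (\<Sum>p | p permutes ?K. signof p *
      (\<Prod>i\<in>?K. principal_submatrix A Y $$ (i, p i)))"
  proof (rule sum.cong[OF refl])
    fix p assume "p \<in> {p. p permutes ?K}"
    then have p: "p permutes ?K" by simp
    have "(\<Prod>i\<in>Y. A $$ (i, map_permutation ?K ?f p i)) =
        (\<Prod>i\<in>?K. A $$ (?f i, map_permutation ?K ?f p (?f i)))"
      by (rule prod.reindex_bij_betw[OF bij, symmetric])
    also have "\<dots> = (\<Prod>i\<in>?K. principal_submatrix A Y $$ (i, p i))"
    proof (rule prod.cong[OF refl])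
      fix i assume i: "i \<in> ?K"
      then have "p i \<in> ?K" using permutes_in_image[OF p] by blast
      then show "A $$ (?f i, map_permutation ?K ?f p (?f i)) = principal_submatrix A Y $$ (i, p i)"
        using i A k unfolding principal_submatrix_def
        by (simp add: map_permutation_apply[OF inj] submatrix_index)
    qed
    finally show "signof (map_permutation ?K ?f p) *
        (\<Prod>i\<in>Y. A $$ (i, map_permutation ?K ?f p i)) =
        signof p * (\<Prod>i\<in>?K. principal_submatrix A Y $$ (i, p i))"
      using sign_map_permutation[OF inj p] by simp
  qed
  also have "\<dots> = det (principal_submatrix A Y)"
    by (rule det_def'[OF dim, symmetric])
  finally show ?thesis by simp
qed

section \<open>Padding a principal submatrix with the identity\<close>

text \<open>
  Extending \<open>A\<^sub>Y\<close> by the identity keeps the determinant while all matrices share the index set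
  of \<open>A\<close>, so that no reindexing is needed when \<open>Y\<close> grows.
\<close>

definition pad_mat :: "'a :: {zero,one} mat \<Rightarrow> nat set \<Rightarrow> 'a mat" where
  "pad_mat A Y = mat (dim_row A) (dim_col A)
    (\<lambda>(i, j). if i \<in> Y \<and> j \<in> Y then A $$ (i, j) else if i = j then 1 else 0)"

lemma pad_mat_carrier [simp]: "A \<in> carrier_mat n m \<Longrightarrow> pad_mat A Y \<in> carrier_mat n m"
  by (auto simp: pad_mat_def)

lemma index_pad_mat:
  "A \<in> carrier_mat n m \<Longrightarrow> i < n \<Longrightarrow> j < m \<Longrightarrow> pad_mat A Y $$ (i, j) =
    (if i \<in> Y \<and> j \<in> Y then A $$ (i, j) else if i = j then 1 else 0)"
  by (auto simp: pad_mat_def)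

text \<open>A permutation that moves an index outside \<open>Y\<close> meets a zero entry of the
  padded matrix, so only permutations of \<open>Y\<close> contribute to the Leibniz sum.\<close>

lemma det_pad_mat:
  fixes A :: "'a :: comm_ring_1 mat"
  assumes A: "A \<in> carrier_mat n n" and Y: "Y \<subseteq> {0..<n}"
  shows "det (pad_mat A Y) = det (principal_submatrix A Y)"
proof -
  let ?P = "pad_mat A Y"
  have in_range: "p i < n" if "p permutes {0..<n}" "i < n" for p i
    using permutes_in_image[OF that(1), of i] that(2) by simp
  have "det ?P = (\<Sum>p | p permutes {0..<n}. signof p * (\<Prod>i=0..<n. ?P $$ (i, p i)))"
    by (rule det_def') (use A in simp)
  also have "\<dots> = (\<Sum>p | p permutes Y. signof p * (\<Prod>i=0..<n. ?P $$ (i, p i)))"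
  proof (rule sum.mono_neutral_right)
    show "finite {p. p permutes {0..<n}}" by (simp add: finite_permutations)
    show "{p. p permutes Y} \<subseteq> {p. p permutes {0..<n}}"
      using Y by (auto intro: permutes_subset)
    show "\<forall>p\<in>{p. p permutes {0..<n}} - {p. p permutes Y}.
        signof p * (\<Prod>i=0..<n. ?P $$ (i, p i)) = 0"
    proof
      fix p assume "p \<in> {p. p permutes {0..<n}} - {p. p permutes Y}"
      then have p: "p permutes {0..<n}" and "\<not> p permutes Y" by auto
      \<comment> \<open>A permutation of \<open>{0..<n}\<close> fixing every index outside
        \<open>Y\<close> would already permute \<open>Y\<close>.\<close>
      then obtain i where i: "i \<in> {0..<n} - Y" "p i \<noteq> i"
        using permutes_superset[OF p] by blast
      then have "?P $$ (i, p i) = 0"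
        using A in_range[OF p, of i] by (auto simp: index_pad_mat)
      then have "(\<Prod>i=0..<n. ?P $$ (i, p i)) = 0"
        using i by (intro prod_zero) auto
      then show "signof p * (\<Prod>i=0..<n. ?P $$ (i, p i)) = 0" by simp
    qed
  qed
  also have "\<dots> = (\<Sum>p | p permutes Y. signof p * (\<Prod>i\<in>Y. A $$ (i, p i)))"
  proof (rule sum.cong[OF refl])
    fix p assume "p \<in> {p. p permutes Y}"
    then have p: "p permutes Y" by simp
    \<comment> \<open>Outside \<open>Y\<close> the permutation is the identity and picks diagonal
      entries, which are 1.\<close>
    have "(\<Prod>i=0..<n. ?P $$ (i, p i)) = (\<Prod>i\<in>Y. ?P $$ (i, p i))"
      using Y A by (intro prod.mono_neutral_right) (auto simp: permutes_not_in[OF p] index_pad_mat)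
    also have "\<dots> = (\<Prod>i\<in>Y. A $$ (i, p i))"
    proof (rule prod.cong[OF refl])
      fix i assume i: "i \<in> Y"
      then have "p i \<in> Y" using permutes_in_image[OF p] by simp
      with i Y A show "?P $$ (i, p i) = A $$ (i, p i)"
        by (subst index_pad_mat[of A n n]) auto
    qed
    finally show "signof p * (\<Prod>i=0..<n. ?P $$ (i, p i)) = signof p * (\<Prod>i\<in>Y. A $$ (i, p i))"
      by simp
  qed
  finally show ?thesis using det_principal_submatrix[OF A Y] by simp
qed

text \<open>Column \<open>j\<close> of the matrix padded for \<open>Y - {j}\<close> is a unit
  vector, so expanding along it leaves a single cofactor. Removing \<open>j\<close> from
  \<open>Y\<close> changes only row and column \<open>j\<close>, which this cofactor
  ignores.\<close>

lemma cofactor_pad_mat: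
  fixes A :: "'a :: comm_ring_1 mat"
  assumes A: "A \<in> carrier_mat n n" and j: "j < n"
  shows "cofactor (pad_mat A Y) j j = det (pad_mat A (Y - {j}))"
proof -
  let ?Q = "pad_mat A (Y - {j})"
  have "mat_delete ?Q j j = mat_delete (pad_mat A Y) j j"
    using A j unfolding mat_delete_def pad_mat_def by (intro eq_matI) auto
  then have cof: "cofactor ?Q j j = cofactor (pad_mat A Y) j j"
    by (simp add: cofactor_def)
  have "det ?Q = (\<Sum>i<n. ?Q $$ (i, j) * cofactor ?Q i j)"
    by (rule laplace_expansion_column[OF pad_mat_carrier[OF A] j])
  also have "\<dots> = (\<Sum>i<n. if i = j then cofactor ?Q j j else 0)"
    using A j by (intro sum.cong) (auto simp: index_pad_mat)
  also have "\<dots> = cofactor ?Q j j" using j by simp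
  finally show ?thesis using cof by simp
qed

text \<open>Translates linear systems for the padded matrix into conditions on \<open>v\<close> off
  \<open>Y\<close> and on \<open>A *\<^sub>v v\<close> on \<open>Y\<close>.\<close>

lemma pad_mat_mult_vec:
  fixes A :: "'a :: comm_ring_1 mat"
  assumes A: "A \<in> carrier_mat n n" and v: "v \<in> carrier_vec n" and i: "i < n"
  shows "i \<notin> Y \<Longrightarrow> (pad_mat A Y *\<^sub>v v) $ i = v $ i"
    and "i \<in> Y \<Longrightarrow> (\<And>k. k < n \<Longrightarrow> k \<notin> Y \<Longrightarrow> v $ k = 0) \<Longrightarrow>
      (pad_mat A Y *\<^sub>v v) $ i = (A *\<^sub>v v) $ i"
proof -
  have P: "pad_mat A Y \<in> carrier_mat n n" using A by simp
  have eq: "(M *\<^sub>v v) $ i = (\<Sum>k=0..<n. M $$ (i, k) * v $ k)" if "M \<in> carrier_mat n n" for M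
    using that v i by (auto simp: scalar_prod_def intro!: sum.cong)
  show "(pad_mat A Y *\<^sub>v v) $ i = v $ i" if "i \<notin> Y"
  proof -
    have "(pad_mat A Y *\<^sub>v v) $ i = (\<Sum>k=0..<n. if i = k then v $ k else 0)"
      unfolding eq[OF P] using that A i by (intro sum.cong) (auto simp: index_pad_mat)
    then show ?thesis using i by simp
  qed
  show "(pad_mat A Y *\<^sub>v v) $ i = (A *\<^sub>v v) $ i"
    if "i \<in> Y" "\<And>k. k < n \<Longrightarrow> k \<notin> Y \<Longrightarrow> v $ k = 0"
    unfolding eq[OF P] eq[OF A] using that A i
    by (intro sum.cong) (auto simp: index_pad_mat)
qed

section \<open>Quadratic forms and nonsingularity\<close>

lemma pos_definite_carrierD:
  assumes "pos_definite L" "L \<in> carrier_mat n n" "x \<in> carrier_vec n"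
  shows "x \<noteq> 0\<^sub>v n \<Longrightarrow> 0 < x \<bullet> (L *\<^sub>v x)" and "0 \<le> x \<bullet> (L *\<^sub>v x)"
proof -
  show pos: "0 < x \<bullet> (L *\<^sub>v x)" if "x \<noteq> 0\<^sub>v n"
    using assms that unfolding pos_definite_def by auto
  show "0 \<le> x \<bullet> (L *\<^sub>v x)"
  proof (cases "x = 0\<^sub>v n")
    case True
    then show ?thesis using assms by simp
  next
    case False
    then show ?thesis using pos by simp
  qed
qed

lemma scalar_prod_mult_mat_vec_commute:
  fixes L :: "'a :: comm_semiring_0 mat"
  assumes "symmetric_mat L" "L \<in> carrier_mat n n" "u \<in> carrier_vec n" "v \<in> carrier_vec n"
  shows "u \<bullet> (L *\<^sub>v v) = v \<bullet> (L *\<^sub>v u)"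
proof -
  have "v \<bullet> (L *\<^sub>v u) = (transpose_mat L *\<^sub>v v) \<bullet> u"
    using transpose_vec_mult_scalar[of L n n u v] assms by simp
  also have "\<dots> = u \<bullet> (L *\<^sub>v v)"
    using assms by (simp add: symmetric_mat_def comm_scalar_prod[of u n])
  finally show ?thesis by simp
qed

text \<open>A kernel vector \<open>v\<close> of the padded matrix vanishes off \<open>Y\<close>
  while \<open>L *\<^sub>v v\<close> vanishes on \<open>Y\<close>; hence the quadratic form of
  \<open>L\<close> is zero at \<open>v\<close>, against positive definiteness.\<close>

lemma det_pad_mat_nonzero:
  assumes PD: "pos_definite L" and L: "L \<in> carrier_mat n n"
  shows "det (pad_mat L Y) \<noteq> 0"
proof
  assume "det (pad_mat L Y) = 0"
  then obtain v where v: "v \<in> carrier_vec n" "v \<noteq> 0\<^sub>v n" "pad_mat L Y *\<^sub>v v = 0\<^sub>v n"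
    using det_0_iff_vec_prod_zero[of "pad_mat L Y" n] L by auto
  have supp: "v $ i = 0" if "i < n" "i \<notin> Y" for i
    using pad_mat_mult_vec(1)[OF L v(1) that] v(3) that by simp
  have "(L *\<^sub>v v) $ i = 0" if "i < n" "i \<in> Y" for i
    using pad_mat_mult_vec(2)[OF L v(1) that supp] v(3) that by simp
  with supp have "v $ i * (L *\<^sub>v v) $ i = 0" if "i < n" for i
    using that by (cases "i \<in> Y") (simp_all del: index_mult_mat_vec)
  then have "v \<bullet> (L *\<^sub>v v) = 0"
    using L by (auto simp: scalar_prod_def simp del: index_mult_mat_vec mult_eq_0_iff
      intro!: sum.neutral)
  with pos_definite_carrierD(1)[OF PD L v(1,2)] show False by simp
qed

section \<open>Columns of inverses of principal submatrices\<close>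

text \<open>\<open>w\<close> is the \<open>j\<close>-th column of the inverse of \<open>L\<^sub>Y\<close>, extended by zero.\<close>

definition is_inverse_column :: "'a :: semiring_1 mat \<Rightarrow> nat set \<Rightarrow> nat \<Rightarrow> 'a vec \<Rightarrow> bool" where
  "is_inverse_column L Y j w \<longleftrightarrow> w \<in> carrier_vec (dim_row L) \<and>
    (\<forall>i<dim_row L. i \<notin> Y \<longrightarrow> w $ i = 0) \<and>
    (\<forall>i<dim_row L. i \<in> Y \<longrightarrow> (L *\<^sub>v w) $ i = (if i = j then 1 else 0))"

text \<open>Cramer's rule: \<open>w\<close> is column \<open>j\<close> of the adjugate of the padded
  matrix divided by its determinant, and its entry at \<open>j\<close> is a quotient of two
  determinants by \<open>cofactor_pad_mat\<close>.\<close>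

lemma inverse_column_exists:
  assumes PD: "pos_definite L" and L: "L \<in> carrier_mat n n" and j: "j < n" "j \<in> Y"
  obtains w where "is_inverse_column L Y j w"
    and "det (pad_mat L (Y - {j})) = w $ j * det (pad_mat L Y)"
proof -
  let ?P = "pad_mat L Y"
  have P: "?P \<in> carrier_mat n n" using L by simp
  have d: "det ?P \<noteq> 0" by (rule det_pad_mat_nonzero[OF PD L])
  define u where "u = col (adj_mat ?P) j"
  define w where "w = (1 / det ?P) \<cdot>\<^sub>v u"
  have u: "u \<in> carrier_vec n" using adj_mat(1)[OF P] j by (auto simp: u_def)
  then have w: "w \<in> carrier_vec n" by (simp add: w_def)
  have "?P *\<^sub>v u = col (?P * adj_mat ?P) j"
    using P adj_mat(1)[OF P] j by (intro eq_vecI) (simp_all add: u_def)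
  then have Pu: "?P *\<^sub>v u = col (det ?P \<cdot>\<^sub>m 1\<^sub>m n) j"
    by (simp add: adj_mat(2)[OF P])
  have Pw: "(?P *\<^sub>v w) $ i = (if i = j then 1 else 0)" if "i < n" for i
  proof -
    have "?P *\<^sub>v w = (1 / det ?P) \<cdot>\<^sub>v (?P *\<^sub>v u)"
      unfolding w_def by (rule mult_mat_vec[OF P u])
    then show ?thesis using that j d unfolding Pu by simp
  qed
  have supp: "w $ i = 0" if "i < n" "i \<notin> Y" for i
  proof -
    \<comment> \<open>Off \<open>Y\<close> the padded matrix acts as the identity, so
      \<open>w $ i\<close> is an entry of the unit vector away from \<open>j\<close>.\<close>
    have "i \<noteq> j" using that j by auto
    then show ?thesis using pad_mat_mult_vec(1)[OF L w that] Pw[OF that(1)] by simp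
  qed
  have "(L *\<^sub>v w) $ i = (if i = j then 1 else 0)" if "i < n" "i \<in> Y" for i
    using pad_mat_mult_vec(2)[OF L w that supp] Pw[OF that(1)] by simp
  then have "is_inverse_column L Y j w"
    using L w supp by (auto simp: is_inverse_column_def)
  moreover have "u $ j = cofactor ?P j j"
    using P j adj_mat(1)[OF P] by (simp add: u_def adj_mat_def)
  then have "det (pad_mat L (Y - {j})) = w $ j * det ?P"
    using cofactor_pad_mat[OF L j(1), of Y] u j d by (simp add: w_def)
  ultimately show ?thesis by (rule that)
qed

text \<open>Off \<open>Y\<close> the vector \<open>a\<close> vanishes, and on \<open>Y\<close>, a
  subset of \<open>Z\<close>, the vector \<open>L *\<^sub>v b\<close> is the unit vector at
  \<open>j\<close>; only the term at \<open>j\<close> survives.\<close>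

lemma scalar_prod_inverse_column:
  assumes L: "L \<in> carrier_mat n n" and j: "j < n" "j \<in> Y" and YZ: "Y \<subseteq> Z"
    and a: "is_inverse_column L Y j a" and b: "is_inverse_column L Z j b"
  shows "a \<bullet> (L *\<^sub>v b) = a $ j"
proof -
  have "a \<bullet> (L *\<^sub>v b) = (\<Sum>i=0..<n. a $ i * (L *\<^sub>v b) $ i)"
    using L by (simp add: scalar_prod_def)
  also have "\<dots> = (\<Sum>i=0..<n. if i = j then a $ j else 0)"
  proof (rule sum.cong[OF refl])
    fix i assume "i \<in> {0..<n}"
    then have i: "i < n" by simp
    show "a $ i * (L *\<^sub>v b) $ i = (if i = j then a $ j else 0)"
    proof (cases "i \<in> Y")
      case True
      then have "(L *\<^sub>v b) $ i = (if i = j then 1 else 0)"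
        using b YZ L i by (auto simp: is_inverse_column_def simp del: index_mult_mat_vec)
      then show ?thesis by simp
    next
      case False
      then have "a $ i = 0" "i \<noteq> j"
        using a L i j by (auto simp: is_inverse_column_def)
      then show ?thesis by simp
    qed
  qed
  also have "\<dots> = a $ j" using j by simp
  finally show ?thesis .
qed

lemma inverse_column_pos:
  assumes PD: "pos_definite L" and L: "L \<in> carrier_mat n n" and j: "j < n" "j \<in> Y"
    and w: "is_inverse_column L Y j w"
  shows "0 < w $ j"
proof -
  have wc: "w \<in> carrier_vec n" using w L by (simp add: is_inverse_column_def)
  have "(L *\<^sub>v w) $ j = 1" using w L j by (simp add: is_inverse_column_def)
  then have "w \<noteq> 0\<^sub>v n" using L j by auto
  then have "0 < w \<bullet> (L *\<^sub>v w)" by (rule pos_definite_carrierD(1)[OF PD L wc])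
  then show ?thesis using scalar_prod_inverse_column[OF L j subset_refl w w] by simp
qed

lemma inverse_column_mono:
  assumes PD: "pos_definite L" and L: "L \<in> carrier_mat n n" and j: "j < n" "j \<in> Y"
    and YZ: "Y \<subseteq> Z"
    and a: "is_inverse_column L Y j a" and b: "is_inverse_column L Z j b"
  shows "a $ j \<le> b $ j"
proof -
  have ac: "a \<in> carrier_vec n" and bc: "b \<in> carrier_vec n"
    using a b L by (auto simp: is_inverse_column_def)
  have La: "L *\<^sub>v a \<in> carrier_vec n" and Lb: "L *\<^sub>v b \<in> carrier_vec n"
    using L ac bc by auto
  have jZ: "j \<in> Z" using j YZ by auto
  have ab: "a \<bullet> (L *\<^sub>v b) = a $ j" by (rule scalar_prod_inverse_column[OF L j YZ a b])
  \<comment> \<open>\<open>scalar_prod_inverse_column\<close> wants the smaller support on the left,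
    so the other mixed term goes through the symmetry of \<open>L\<close>.\<close>
  have ba: "b \<bullet> (L *\<^sub>v a) = a $ j"
    using scalar_prod_mult_mat_vec_commute[OF _ L bc ac] PD ab
    by (simp add: pos_definite_def)
  have aa: "a \<bullet> (L *\<^sub>v a) = a $ j" and bb: "b \<bullet> (L *\<^sub>v b) = b $ j"
    using scalar_prod_inverse_column[OF L j subset_refl a a]
      scalar_prod_inverse_column[OF L j(1) jZ subset_refl b b] by auto
  have "0 \<le> (b - a) \<bullet> (L *\<^sub>v (b - a))"
    using ac bc by (intro pos_definite_carrierD(2)[OF PD L]) auto
  also have "L *\<^sub>v (b - a) = L *\<^sub>v b - L *\<^sub>v a"
    by (rule mult_minus_distrib_mat_vec[OF L bc ac])
  also have "(b - a) \<bullet> \<dots> = b \<bullet> (L *\<^sub>v b) - b \<bullet> (L *\<^sub>v a) - (a \<bullet> (L *\<^sub>v b) - a \<bullet> (L *\<^sub>v a))"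
    using ac bc La Lb
    by (simp add: minus_scalar_prod_distrib[of b n a] scalar_prod_minus_distrib[of _ n])
  finally show ?thesis using aa bb ab ba by simp
qed

lemma inverse_column_le_one:
  assumes LI: "loewner_le (1\<^sub>m n) L" and L: "L \<in> carrier_mat n n" and j: "j < n" "j \<in> Y"
    and w: "is_inverse_column L Y j w"
  shows "w $ j \<le> 1"
proof -
  have wc: "w \<in> carrier_vec n" using w L by (simp add: is_inverse_column_def)
  have Lw: "L *\<^sub>v w \<in> carrier_vec n" using L wc by auto
  have "0 \<le> w \<bullet> ((L - 1\<^sub>m n) *\<^sub>v w)"
    using LI L wc unfolding loewner_le_def pos_semidefinite_def by auto
  also have "(L - 1\<^sub>m n) *\<^sub>v w = L *\<^sub>v w - w"
    using minus_mult_distrib_mat_vec[OF L one_carrier_mat wc] wc by simp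
  also have "w \<bullet> (L *\<^sub>v w - w) = w $ j - w \<bullet> w"
    using scalar_prod_inverse_column[OF L j subset_refl w w]
    by (simp add: scalar_prod_minus_distrib[OF wc Lw wc])
  finally have le: "w \<bullet> w \<le> w $ j" by simp
  have "w $ j * w $ j \<le> (\<Sum>i=0..<n. w $ i * w $ i)"
    using j by (intro member_le_sum) auto
  also have "\<dots> = w \<bullet> w" using wc by (simp add: scalar_prod_def)
  finally have "w $ j * w $ j \<le> w $ j" using le by simp
  \<comment> \<open>If \<open>w $ j\<close> exceeded 1, its square would exceed
    \<open>w $ j\<close>.\<close>
  then show ?thesis
    using mult_strict_left_mono[of 1 "w $ j" "w $ j"] by (cases "w $ j \<le> 1") auto
qed

section \<open>Positive minors and marginal gains\<close>

text \<open>Induction on \<open>Y\<close>: by Cramer's rule the old determinant is a positive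
  multiple of the new one, so positivity passes from \<open>Y\<close> to \<open>insert j Y\<close>,
  starting from the empty determinant 1.\<close>

lemma det_pad_mat_pos:
  assumes PD: "pos_definite L" and L: "L \<in> carrier_mat n n" and Y: "Y \<subseteq> {0..<n}"
  shows "0 < det (pad_mat L Y)"
proof -
  have "finite Y" using Y finite_subset by blast
  then show ?thesis using Y
  proof induction
    case empty
    then show ?case using det_pad_mat[OF L, of "{}"] det_principal_submatrix_empty[of L] by simp
  next
    case (insert j Y)
    then have j: "j < n" "j \<in> insert j Y" by auto
    obtain w where w: "is_inverse_column L (insert j Y) j w"
      and eq: "det (pad_mat L (insert j Y - {j})) = w $ j * det (pad_mat L (insert j Y))"
      by (rule inverse_column_exists[OF PD L j])
    have "insert j Y - {j} = Y" using insert by auto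
    with insert eq have "0 < w $ j * det (pad_mat L (insert j Y))" by simp
    with inverse_column_pos[OF PD L j w] show ?case
      by (simp add: zero_less_mult_iff)
  qed
qed

text \<open>Taking \<open>ln\<close> of Cramer's identity reduces both claims of the theorem to
  bounds on the single entry \<open>w $ j\<close>; positivity of both factors makes
  \<open>ln\<close> split.\<close>

lemma log_det_marginal:
  assumes PD: "pos_definite L" and L: "L \<in> carrier_mat n n"
    and A: "A \<subseteq> {0..<n}" and j: "j \<in> {0..<n} - A"
  obtains w where "is_inverse_column L (A \<union> {j}) j w" "0 < w $ j"
    and "log_det L (A \<union> {j}) - log_det L A = - ln (w $ j)"
proof -
  have j': "j < n" "j \<in> A \<union> {j}" and Aj: "A \<union> {j} \<subseteq> {0..<n}" using A j by auto
  obtain w where w: "is_inverse_column L (A \<union> {j}) j w"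
    and eq: "det (pad_mat L (A \<union> {j} - {j})) = w $ j * det (pad_mat L (A \<union> {j}))"
    by (rule inverse_column_exists[OF PD L j'])
  have pos: "0 < w $ j" by (rule inverse_column_pos[OF PD L j' w])
  have "A \<union> {j} - {j} = A" using j by auto
  with eq have "det (pad_mat L A) = w $ j * det (pad_mat L (A \<union> {j}))" by simp
  then have "ln (det (pad_mat L A)) = ln (w $ j) + ln (det (pad_mat L (A \<union> {j})))"
    using pos det_pad_mat_pos[OF PD L Aj] by (simp add: ln_mult)
  then have "log_det L (A \<union> {j}) - log_det L A = - ln (w $ j)"
    unfolding log_det_def det_pad_mat[OF L A] det_pad_mat[OF L Aj] by simp
  with w pos show ?thesis by (rule that)
qed

theorem lemma1:
  fixes n :: nat and L :: "real mat"
  assumes "L \<in> carrier_mat n n"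
    and "pos_definite L"
  shows "submodular_on {0..<n} (log_det L) \<and> log_det L {} = 0 \<and>
    (loewner_le (1\<^sub>m n) L \<longrightarrow> monotone_set_function_on {0..<n} (log_det L))"
proof (intro conjI impI)
  note L = assms(1) and PD = assms(2)
  show "log_det L {} = 0"
    by (simp add: log_det_def det_principal_submatrix_empty)
  show "submodular_on {0..<n} (log_det L)"
    unfolding submodular_on_def
  proof (intro allI impI, elim conjE)
    fix A B j
    assume AB: "A \<subseteq> B" and B: "B \<subseteq> {0..<n}" and j: "j \<in> {0..<n} - B"
    have A: "A \<subseteq> {0..<n}" and jA: "j \<in> {0..<n} - A" using AB B j by auto
    obtain a where a: "is_inverse_column L (A \<union> {j}) j a" "0 < a $ j"
      "log_det L (A \<union> {j}) - log_det L A = - ln (a $ j)"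
      by (rule log_det_marginal[OF PD L A jA])
    obtain b where b: "is_inverse_column L (B \<union> {j}) j b" "0 < b $ j"
      "log_det L (B \<union> {j}) - log_det L B = - ln (b $ j)"
      by (rule log_det_marginal[OF PD L B j])
    have "a $ j \<le> b $ j"
      using AB j by (intro inverse_column_mono[OF PD L _ _ _ a(1) b(1)]) auto
    with a b show "log_det L (A \<union> {j}) - log_det L A \<ge> log_det L (B \<union> {j}) - log_det L B"
      by simp
  qed
  show "monotone_set_function_on {0..<n} (log_det L)" if LI: "loewner_le (1\<^sub>m n) L"
    unfolding monotone_set_function_on_def
  proof (intro allI impI, elim conjE)
    fix A j
    assume A: "A \<subseteq> {0..<n}" and j: "j \<in> {0..<n} - A"
    obtain w where w: "is_inverse_column L (A \<union> {j}) j w" "0 < w $ j"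
      "log_det L (A \<union> {j}) - log_det L A = - ln (w $ j)"
      by (rule log_det_marginal[OF PD L A j])
    have "w $ j \<le> 1"
      using j by (intro inverse_column_le_one[OF LI L _ _ w(1)]) auto
    with w(2) have "ln (w $ j) \<le> 0" by simp
    with w(3) show "log_det L A \<le> log_det L (A \<union> {j})" by simp
  qed
qed

end
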